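(* Let $N\ge 1$ be an integer. For every integer $n\ge 1$, $$ BC_{N,n}=\Pi(n)\sum_{k=1}^{n}(-D_N)^k\sum_{\substack{i_1,\dots,i_k\ge 1\\ r^{N+i_1}+\cdots+r^{N+i_k}=n+k r^N}}\frac{1}{D_{N+i_1}\cdots D_{N+i_k}}\,. $$
   Context: Let $r$ be a power of a prime, $T$ an indeterminate and $K=\mathbb F_r(T)$. For $i\ge 1$ put $[i]=T^{r^i}-T$ and $D_i=[i][i-1]^r[i-2]^{r^2}\cdots[1]^{r^{i-1}}$, with $D_0=1$. The Carlitz exponential is the formal power series $e_C(x)=\sum_{i=0}^\infty x^{r^i}/D_i\in K[[x]]$. For a non-negative integer $i$ with base-$r$ expansion $i=\sum_{j=0}^m c_j r^j$ ($0\le c_j<r$), the Carlitz factorial is $\Pi(i)=\prod_{j=0}^m D_j^{c_j}$. For $N\ge 1$, the truncated Bernoulli-Carlitz numbers $BC_{N,n}\in K$ are defined by the formal power series identity $$ \frac{x^{r^N}/D_N}{e_C(x)-\sum_{i=0}^{N-1}x^{r^i}/D_i}=\sum_{n=0}^\infty\frac{BC_{N,n}}{\Pi(n)}x^n . $$ *)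

theory Defs
  imports
    "HOL-Library.Cardinality"
    "HOL-Computational_Algebra.Polynomial"
    "HOL-Computational_Algebra.Fraction_Field"
    "HOL-Computational_Algebra.Formal_Power_Series"
begin

(* The type 'a plays the role of the field F_r, so that r = CARD('a) and K = 'a poly fract. *)

definition carlitz_T :: "'a::finite_field poly fract" where
  "carlitz_T = Fract [:0, 1:] 1"

definition carlitz_bracket :: "nat \<Rightarrow> 'a::finite_field poly fract" where
  "carlitz_bracket i = carlitz_T ^ (CARD('a) ^ i) - carlitz_T"

definition carlitz_D :: "nat \<Rightarrow> 'a::finite_field poly fract" where
  "carlitz_D i = (\<Prod>j<i. carlitz_bracket (i - j) ^ (CARD('a) ^ j))"

(* The sum in the n-th coefficient has at most one term; see carlitz_exp_nth_power
   and carlitz_exp_nth_other. *)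
definition carlitz_exp :: "'a::finite_field poly fract fps" where
  "carlitz_exp = Abs_fps (\<lambda>n. \<Sum>i | CARD('a) ^ i = n. 1 / carlitz_D i)"

(* (n div r^j) mod r is the j-th base-r digit of n; it vanishes for j > n. *)
definition carlitz_factorial :: "nat \<Rightarrow> 'a::finite_field poly fract" where
  "carlitz_factorial n = (\<Prod>j\<le>n. carlitz_D j ^ (n div CARD('a) ^ j mod CARD('a)))"

definition truncated_bernoulli_carlitz_num :: "nat \<Rightarrow> 'a::finite_field poly fract fps" where
  "truncated_bernoulli_carlitz_num N = fps_const (1 / carlitz_D N) * fps_X ^ (CARD('a) ^ N)"

definition truncated_bernoulli_carlitz_den :: "nat \<Rightarrow> 'a::finite_field poly fract fps" where
  "truncated_bernoulli_carlitz_den N =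
     carlitz_exp - (\<Sum>i<N. fps_const (1 / carlitz_D i) * fps_X ^ (CARD('a) ^ i))"

(* The quotient is a power series although the denominator is not a unit; see
   truncated_bernoulli_carlitz_gf. *)
definition truncated_bernoulli_carlitz :: "nat \<Rightarrow> nat \<Rightarrow> 'a::finite_field poly fract" where
  "truncated_bernoulli_carlitz N n = carlitz_factorial n *
     fps_nth (truncated_bernoulli_carlitz_num N / truncated_bernoulli_carlitz_den N) n"

lemma card_field_gt_1: "CARD('a::finite_field) > 1"
proof -
  have "card {0, 1 :: 'a} \<le> CARD('a)" by (rule card_mono) auto
  thus ?thesis by simp
qed

lemma carlitz_T_power: "(carlitz_T :: 'a::finite_field poly fract) ^ n = Fract (monom 1 n) 1"
  by (induction n) (simp_all add: carlitz_T_def One_fract_def monom_Suc)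

lemma carlitz_bracket_nonzero:
  assumes "i > 0"
  shows "(carlitz_bracket i :: 'a::finite_field poly fract) \<noteq> 0"
proof
  assume "(carlitz_bracket i :: 'a poly fract) = 0"
  hence "(carlitz_T :: 'a poly fract) ^ (CARD('a) ^ i) = carlitz_T ^ 1"
    by (simp add: carlitz_bracket_def)
  hence "(monom 1 (CARD('a) ^ i) :: 'a poly) = monom 1 1"
    by (simp only: carlitz_T_power) (simp add: eq_fract)
  hence "degree (monom 1 (CARD('a) ^ i) :: 'a poly) = degree (monom 1 1 :: 'a poly)"
    by (rule arg_cong)
  hence "CARD('a) ^ i = 1" by (simp add: degree_monom_eq)
  moreover have "CARD('a) ^ i > 1"
    using card_field_gt_1 assms by (rule one_less_power)
  ultimately show False by linarith
qed

lemma carlitz_D_nonzero: "(carlitz_D i :: 'a::finite_field poly fract) \<noteq> 0"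
  by (simp add: carlitz_D_def carlitz_bracket_nonzero)

lemma carlitz_D_0: "carlitz_D 0 = 1"
  by (simp add: carlitz_D_def)

lemma carlitz_factorial_nonzero: "(carlitz_factorial n :: 'a::finite_field poly fract) \<noteq> 0"
  by (simp add: carlitz_factorial_def carlitz_D_nonzero)

lemma carlitz_exp_nth_power:
  "fps_nth (carlitz_exp :: 'a::finite_field poly fract fps) (CARD('a) ^ i) = 1 / carlitz_D i"
proof -
  have "{j. CARD('a) ^ j = CARD('a) ^ i} = {i}"
    using card_field_gt_1[where 'a = 'a] by (auto dest: power_inject_exp)
  thus ?thesis by (simp add: carlitz_exp_def)
qed

lemma carlitz_exp_nth_other:
  "n \<notin> range (\<lambda>i. CARD('a) ^ i) \<Longrightarrow>
     fps_nth (carlitz_exp :: 'a::finite_field poly fract fps) n = 0"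
  by (auto simp: carlitz_exp_def intro!: sum.neutral)

lemma truncated_bernoulli_carlitz_gf:
  "Abs_fps (\<lambda>n. truncated_bernoulli_carlitz N n / carlitz_factorial n) *
     truncated_bernoulli_carlitz_den N =
   (truncated_bernoulli_carlitz_num N :: 'a::finite_field poly fract fps)"
proof -
  let ?f = "truncated_bernoulli_carlitz_num N :: 'a poly fract fps"
  let ?g = "truncated_bernoulli_carlitz_den N :: 'a poly fract fps"
  have *: "CARD('a) ^ N \<noteq> CARD('a) ^ i" if "i < N" for i
    using power_strict_increasing[OF that card_field_gt_1[where 'a = 'a]] by simp
  have "fps_nth ?g (CARD('a) ^ N) = 1 / carlitz_D N"
    by (simp add: truncated_bernoulli_carlitz_den_def carlitz_exp_nth_power fps_sum_nth *)
  hence g: "fps_nth ?g (CARD('a) ^ N) \<noteq> 0" by (simp add: carlitz_D_nonzero)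
  have f: "subdegree ?f = CARD('a) ^ N"
    by (simp add: truncated_bernoulli_carlitz_num_def carlitz_D_nonzero)
  have "?g \<noteq> 0" using g by auto
  moreover have "?f \<noteq> 0" by (simp add: truncated_bernoulli_carlitz_num_def carlitz_D_nonzero)
  moreover have "subdegree ?g \<le> subdegree ?f" unfolding f by (rule subdegree_leI[OF g])
  ultimately have "?g dvd ?f" by (simp add: fps_dvd_iff)
  hence "?f / ?g * ?g = ?f" by simp
  moreover have "Abs_fps (\<lambda>n. truncated_bernoulli_carlitz N n / carlitz_factorial n) = ?f / ?g"
    by (rule fps_ext) (simp add: truncated_bernoulli_carlitz_def carlitz_factorial_nonzero)
  ultimately show ?thesis by simp
qed

end

theory Submission
  imports Defs
begin

text \<open>
  Dividing \<open>e\<^sub>C(x) - (\<Sum>i<N. x^(r^i)/D\<^sub>i)\<close> by \<open>x^(r^N)/D\<^sub>N\<close> gives \<open>1 - h\<close> with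
  \<open>h = (\<Sum>i\<ge>1. (-D\<^sub>N/D\<^bsub>N+i\<^esub>) x^(r^(N+i) - r^N))\<close>. Since \<open>h\<close> has no constant term, the generating
  function is the geometric series in \<open>h\<close>, and only \<open>h^k\<close> with \<open>k \<le> n\<close> contributes to the
  \<open>n\<close>-th coefficient. Multiplying out \<open>h^k\<close> yields one term per \<open>k\<close>-tuple of exponents.
\<close>

text \<open>The bound \<open>w i <= m\<close> on the head makes the natural subtraction
  \<open>m - w i\<close> exact, so consing back produces no spurious lists. This is the recursion
  behind both the finiteness and the coefficient formula below.\<close>

lemma list_sum_Suc_eq_image:
  fixes w :: "'i \<Rightarrow> nat"
  shows "{is. length is = Suc k \<and> set is \<subseteq> I \<and> (\<Sum>i\<leftarrow>is. w i) = m} =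
    (\<lambda>(i, is). i # is) `
      (SIGMA i:{i\<in>I. w i \<le> m}. {is. length is = k \<and> set is \<subseteq> I \<and> (\<Sum>i\<leftarrow>is. w i) = m - w i})"
proof (intro equalityI subsetI)
  fix xs assume "xs \<in> {is. length is = Suc k \<and> set is \<subseteq> I \<and> (\<Sum>i\<leftarrow>is. w i) = m}"
  then obtain y ys where "xs = y # ys" "length ys = k" "y \<in> I" "set ys \<subseteq> I"
    "w y + (\<Sum>i\<leftarrow>ys. w i) = m"
    by (cases xs) auto
  thus "xs \<in> (\<lambda>(i, is). i # is) `
      (SIGMA i:{i\<in>I. w i \<le> m}. {is. length is = k \<and> set is \<subseteq> I \<and> (\<Sum>i\<leftarrow>is. w i) = m - w i})"
    by (intro image_eqI[of _ _ "(y, ys)"]) auto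
qed auto

lemma finite_list_sum_eq:
  fixes w :: "'i \<Rightarrow> nat"
  assumes "\<And>m. finite {i\<in>I. w i \<le> m}"
  shows "finite {is. length is = k \<and> set is \<subseteq> I \<and> (\<Sum>i\<leftarrow>is. w i) = m}"
proof (induction k arbitrary: m)
  case 0
  show ?case by (rule finite_subset[of _ "{[]}"]) auto
next
  case (Suc k)
  show ?case
    unfolding list_sum_Suc_eq_image by (intro finite_imageI finite_SigmaI assms Suc.IH)
qed

text \<open>Expanding the product picks one index from each factor, so lists index the terms.
  Distinct indices may share a weight, hence the sum in \<open>f\<close>; by \<open>fin\<close> all
  these sums are finite, so none collapses to the default value 0.\<close>

lemma fps_power_nth_weighted:
  fixes w :: "'i \<Rightarrow> nat" and c :: "'i \<Rightarrow> 'b::comm_ring_1"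
  assumes fin: "\<And>m. finite {i\<in>I. w i \<le> m}"
  defines "f \<equiv> Abs_fps (\<lambda>m. \<Sum>i | i \<in> I \<and> w i = m. c i)"
  shows "fps_nth (f ^ k) m =
    (\<Sum>is | length is = k \<and> set is \<subseteq> I \<and> (\<Sum>i\<leftarrow>is. w i) = m. \<Prod>i\<leftarrow>is. c i)"
proof (induction k arbitrary: m)
  case 0
  have "{is. length is = 0 \<and> set is \<subseteq> I \<and> (\<Sum>i\<leftarrow>is. w i) = m} = (if m = 0 then {[]} else {})"
    by auto
  thus ?case by simp
next
  case (Suc k)
  let ?L = "\<lambda>m. {is. length is = k \<and> set is \<subseteq> I \<and> (\<Sum>i\<leftarrow>is. w i) = m}"
  have "fps_nth (f ^ Suc k) m = (\<Sum>j\<le>m. fps_nth f j * fps_nth (f ^ k) (m - j))"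
    by (simp add: fps_mult_nth atMost_atLeast0)
  \<comment> \<open>Since \<open>j <= m\<close>, the cut-off \<open>w i <= m\<close> loses nothing,
    and it supplies the finite index set needed for regrouping by weight.\<close>
  also have "\<dots> = (\<Sum>j\<le>m. \<Sum>i | i \<in> {i\<in>I. w i \<le> m} \<and> w i = j. c i * fps_nth (f ^ k) (m - w i))"
    by (intro sum.cong refl) (auto simp: f_def sum_distrib_right intro!: sum.cong)
  also have "\<dots> = (\<Sum>i | i \<in> I \<and> w i \<le> m. c i * fps_nth (f ^ k) (m - w i))"
    by (rule sum.group) (use fin in auto)
  also have "\<dots> = (\<Sum>i | i \<in> I \<and> w i \<le> m. \<Sum>is\<in>?L (m - w i). \<Prod>j\<leftarrow>i # is. c j)"
    by (simp add: Suc.IH sum_distrib_left)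
  also have "\<dots> = (\<Sum>(i, is)\<in>(SIGMA i:{i\<in>I. w i \<le> m}. ?L (m - w i)). \<Prod>j\<leftarrow>i # is. c j)"
    by (intro sum.Sigma ballI fin finite_list_sum_eq)
  also have "\<dots> = (\<Sum>is | length is = Suc k \<and> set is \<subseteq> I \<and> (\<Sum>i\<leftarrow>is. w i) = m. \<Prod>i\<leftarrow>is. c i)"
    unfolding list_sum_Suc_eq_image
    by (subst sum.reindex) (auto simp: inj_on_def case_prod_unfold)
  finally show ?case .
qed

text \<open>The partial geometric sum up to \<open>h ^ n\<close> differs from \<open>q\<close> by
  \<open>q * h ^ Suc n\<close>, which only has terms of degree above \<open>n\<close>.\<close>

lemma fps_nth_geometric:
  fixes q h :: "'b::comm_ring_1 fps"
  assumes inv: "q * (1 - h) = 1" and h0: "fps_nth h 0 = 0"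
  shows "fps_nth q n = (\<Sum>k\<le>n. fps_nth (h ^ k) n)"
proof -
  have "(\<Sum>k\<le>n. h ^ k) = q * ((1 - h) * (\<Sum>k\<le>n. h ^ k))"
    using inv by (simp flip: mult.assoc)
  also have "\<dots> = q - q * h ^ Suc n"
    by (simp only: sum_gp_basic right_diff_distrib mult_1_right)
  finally have "q = (\<Sum>k\<le>n. h ^ k) + q * h ^ Suc n" by simp
  moreover have "fps_nth (q * h ^ Suc n) n = 0"
    using startsby_zero_power_prefix[OF h0, of "Suc n"]
    by (auto simp: fps_mult_nth simp del: power_Suc intro!: sum.neutral)
  ultimately show ?thesis by (metis add.right_neutral fps_add_nth fps_sum_nth)
qed

lemma less_card_power: "n < CARD('a::finite_field) ^ n"
  using power_gt_expt[of "CARD('a)" n] card_field_gt_1[where 'a = 'a] by simp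

text \<open>The subtracted polynomial cancels exactly the indices \<open>i < N\<close> of the
  exponential. Summing over all \<open>i\<close> with \<open>r^i = m\<close> avoids asking whether
  \<open>m\<close> is a power of \<open>r\<close>.\<close>

lemma truncated_bernoulli_carlitz_den_nth:
  "fps_nth (truncated_bernoulli_carlitz_den N :: 'a::finite_field poly fract fps) m =
    (\<Sum>i | N \<le> i \<and> CARD('a) ^ i = m. 1 / carlitz_D i)"
proof -
  have "finite {i. CARD('a) ^ i = m}"
    by (rule finite_subset[of _ "{..m}"])
      (auto intro: less_imp_le less_card_power)
  hence "(\<Sum>i | CARD('a) ^ i = m. 1 / carlitz_D i :: 'a poly fract) =
    (\<Sum>i\<in>{i. N \<le> i \<and> CARD('a) ^ i = m} \<union> {i. i < N \<and> CARD('a) ^ i = m}. 1 / carlitz_D i)"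
    by (intro sum.cong) auto
  also have "\<dots> = (\<Sum>i | N \<le> i \<and> CARD('a) ^ i = m. 1 / carlitz_D i) +
      (\<Sum>i | i < N \<and> CARD('a) ^ i = m. 1 / carlitz_D i)"
    by (rule sum.union_disjoint)
      (auto intro: finite_subset[OF _ \<open>finite {i. CARD('a) ^ i = m}\<close>])
  also have "(\<Sum>i | i < N \<and> CARD('a) ^ i = m. 1 / carlitz_D i :: 'a poly fract) =
      (\<Sum>i<N. if m = CARD('a) ^ i then 1 / carlitz_D i else 0)"
    by (auto simp: sum.inter_filter[symmetric] intro!: sum.cong)
  finally show ?thesis
    by (simp add: truncated_bernoulli_carlitz_den_def carlitz_exp_def fps_sum_nth
        if_distrib cong: if_cong)
qed

text \<open>This is the series \<open>h\<close> of the overview. Its sign is chosen so that the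
  quotient is \<open>1 / (1 - h)\<close>, and its shape fits
  \<open>fps_power_nth_weighted\<close>.\<close>

definition truncated_bernoulli_carlitz_ratio :: "nat \<Rightarrow> 'a::finite_field poly fract fps" where
  "truncated_bernoulli_carlitz_ratio N =
    Abs_fps (\<lambda>m. \<Sum>i | i \<in> {1..} \<and> CARD('a) ^ (N + i) - CARD('a) ^ N = m.
      - carlitz_D N / carlitz_D (N + i))"

lemma card_power_less:
  assumes "i \<ge> 1"
  shows "CARD('a::finite_field) ^ N < CARD('a) ^ (N + i)"
  using assms by (intro power_strict_increasing card_field_gt_1) auto

lemma truncated_bernoulli_carlitz_ratio_nth_0:
  "fps_nth (truncated_bernoulli_carlitz_ratio N :: 'a::finite_field poly fract fps) 0 = 0"
proof -
  have "{i. i \<in> {1..} \<and> CARD('a) ^ (N + i) - CARD('a) ^ N = 0} = {}"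
    using card_power_less[where 'a = 'a and N = N]
    by (metis (mono_tags, lifting) atLeast_iff empty_Collect_eq zero_less_diff less_irrefl)
  thus ?thesis
    by (simp only: truncated_bernoulli_carlitz_ratio_def fps_nth_Abs_fps sum.empty)
qed

lemma truncated_bernoulli_carlitz_den_eq:
  "truncated_bernoulli_carlitz_den N =
    truncated_bernoulli_carlitz_num N *
      (1 - truncated_bernoulli_carlitz_ratio N :: 'a::finite_field poly fract fps)"
proof (rule fps_ext)
  fix m
  let ?r = "CARD('a)"
  let ?u = "1 - truncated_bernoulli_carlitz_ratio N :: 'a poly fract fps"
  have num: "fps_nth (truncated_bernoulli_carlitz_num N * ?u) m =
      (if m < ?r ^ N then 0 else fps_nth ?u (m - ?r ^ N) / carlitz_D N)"
    by (simp add: truncated_bernoulli_carlitz_num_def mult.assoc fps_X_power_mult_nth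
        del: fps_sub_nth)
  consider (less) "m < ?r ^ N" | (eq) "m = ?r ^ N" | (greater) "m > ?r ^ N" by linarith
  thus "fps_nth (truncated_bernoulli_carlitz_den N :: 'a poly fract fps) m =
      fps_nth (truncated_bernoulli_carlitz_num N * ?u) m"
  proof cases
    case less
    have "?r ^ N \<le> ?r ^ i" if "N \<le> i" for i
      using that by (intro power_increasing) auto
    hence "{i. N \<le> i \<and> ?r ^ i = m} = {}" using less by force
    thus ?thesis
      using less by (simp only: num truncated_bernoulli_carlitz_den_nth sum.empty if_True)
  next
    case eq
    have "{i. N \<le> i \<and> ?r ^ i = m} = {N}"
      using eq card_field_gt_1[where 'a = 'a] by (auto dest: power_inject_exp)
    thus ?thesis unfolding num truncated_bernoulli_carlitz_den_nth
      using eq by (simp add: truncated_bernoulli_carlitz_ratio_nth_0)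
  next
    case greater
    \<comment> \<open>As \<open>m > r^N\<close>, the index \<open>i = N\<close> is excluded, so
      every \<open>i\<close> is \<open>N + j\<close> with \<open>j >= 1\<close>; subtracting
      \<open>r^N\<close> is exact on both sides.\<close>
    have "{i. N \<le> i \<and> ?r ^ i = m} = (+) N ` {i. i \<in> {1..} \<and> ?r ^ (N + i) - ?r ^ N = m - ?r ^ N}"
    proof (intro equalityI subsetI)
      fix i assume i: "i \<in> {i. N \<le> i \<and> ?r ^ i = m}"
      hence "N < i" using greater by (auto simp: le_less)
      thus "i \<in> (+) N ` {i. i \<in> {1..} \<and> ?r ^ (N + i) - ?r ^ N = m - ?r ^ N}"
        using i by (intro image_eqI[of _ _ "i - N"]) auto
    next
      fix i assume "i \<in> (+) N ` {i. i \<in> {1..} \<and> ?r ^ (N + i) - ?r ^ N = m - ?r ^ N}"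
      then obtain j where "i = N + j" "j \<ge> 1" "?r ^ (N + j) - ?r ^ N = m - ?r ^ N" by auto
      thus "i \<in> {i. N \<le> i \<and> ?r ^ i = m}"
        using greater card_power_less[where 'a = 'a and N = N and i = j] by simp
    qed
    hence "fps_nth (truncated_bernoulli_carlitz_den N :: 'a poly fract fps) m =
        (\<Sum>i | i \<in> {1..} \<and> ?r ^ (N + i) - ?r ^ N = m - ?r ^ N. 1 / carlitz_D (N + i))"
      unfolding truncated_bernoulli_carlitz_den_nth by (simp add: sum.reindex)
    \<comment> \<open>The constant 1 in \<open>?u\<close> does not contribute, because
      \<open>m - r^N > 0\<close>; the two minus signs and the factors \<open>carlitz_D N\<close>
      cancel.\<close>
    also have "\<dots> = fps_nth ?u (m - ?r ^ N) / carlitz_D N"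
      using greater
      by (simp add: truncated_bernoulli_carlitz_ratio_def sum_negf sum_divide_distrib
          carlitz_D_nonzero)
    finally show ?thesis using greater num by simp
  qed
qed

lemma sum_list_card_power_diff:
  assumes "\<forall>i\<in>set is. i \<ge> 1"
  shows "(\<Sum>i\<leftarrow>is. CARD('a::finite_field) ^ (N + i)) =
    (\<Sum>i\<leftarrow>is. CARD('a) ^ (N + i) - CARD('a) ^ N) + length is * CARD('a) ^ N"
  using assms
proof (induction "is")
  case (Cons i "is")
  thus ?case using card_power_less[where 'a = 'a and N = N and i = i] by simp
qed simp

lemma prod_list_const_divide:
  fixes c :: "'b::field"
  shows "(\<Prod>i\<leftarrow>is. c / g i) = c ^ length is * (1 / (\<Prod>i\<leftarrow>is. g i))"
  by (induction "is") auto

lemma truncated_bernoulli_carlitz_ratio_power_nth: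
  "fps_nth (truncated_bernoulli_carlitz_ratio N ^ k :: 'a::finite_field poly fract fps) n =
    (- carlitz_D N) ^ k *
      (\<Sum>is | length is = k \<and> (\<forall>i\<in>set is. i \<ge> 1) \<and>
              (\<Sum>i\<leftarrow>is. CARD('a) ^ (N + i)) = n + k * CARD('a) ^ N.
        1 / (\<Prod>i\<leftarrow>is. carlitz_D (N + i)))"
proof -
  let ?w = "\<lambda>i. CARD('a) ^ (N + i) - CARD('a) ^ N"
  have fin: "finite {i \<in> {1..}. ?w i \<le> m}" for m
  proof (rule finite_subset)
    show "{i \<in> {1..}. ?w i \<le> m} \<subseteq> {..m + CARD('a) ^ N}"
    proof
      fix i assume "i \<in> {i \<in> {1..}. ?w i \<le> m}"
      \<comment> \<open>Together with \<open>r^(N+i) <= m + r^N\<close> this bounds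
        \<open>i\<close>.\<close>
      moreover have "N + i < CARD('a) ^ (N + i)"
        by (rule less_card_power)
      ultimately have "i \<le> m + CARD('a) ^ N" unfolding mem_Collect_eq by linarith
      thus "i \<in> {..m + CARD('a) ^ N}" by simp
    qed
  qed simp
  have "{is. length is = k \<and> set is \<subseteq> {1..} \<and> (\<Sum>i\<leftarrow>is. ?w i) = n} =
      {is. length is = k \<and> (\<forall>i\<in>set is. i \<ge> 1) \<and>
        (\<Sum>i\<leftarrow>is. CARD('a) ^ (N + i)) = n + k * CARD('a) ^ N}"
  proof (intro Collect_cong conj_cong refl)
    fix xs :: "nat list"
    assume k: "length xs = k"
    show "set xs \<subseteq> {1..} \<longleftrightarrow> (\<forall>i\<in>set xs. i \<ge> 1)" by auto
    \<comment> \<open>Positive entries allow adding \<open>r^N\<close> back to each of the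
      \<open>k\<close> weights, which turns the total \<open>n\<close> into
      \<open>n + k * r^N\<close>.\<close>
    assume "\<forall>i\<in>set xs. i \<ge> 1"
    thus "(\<Sum>i\<leftarrow>xs. ?w i) = n \<longleftrightarrow> (\<Sum>i\<leftarrow>xs. CARD('a) ^ (N + i)) = n + k * CARD('a) ^ N"
      using k by (simp add: sum_list_card_power_diff)
  qed
  thus ?thesis
    unfolding truncated_bernoulli_carlitz_ratio_def
    by (simp only: fps_power_nth_weighted[OF fin] prod_list_const_divide)
      (auto simp: sum_distrib_left intro!: sum.cong)
qed

theorem theorem1:
  fixes N n :: nat
  assumes "N \<ge> 1" and "n \<ge> 1"
  shows "(truncated_bernoulli_carlitz N n :: 'a::finite_field poly fract) =
    carlitz_factorial n *
      (\<Sum>k = 1..n. (- carlitz_D N) ^ k *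
        (\<Sum>is | length is = k \<and> (\<forall>i\<in>set is. i \<ge> 1) \<and>
                (\<Sum>i\<leftarrow>is. CARD('a) ^ (N + i)) = n + k * CARD('a) ^ N.
          1 / (\<Prod>i\<leftarrow>is. carlitz_D (N + i))))"
proof -
  let ?h = "truncated_bernoulli_carlitz_ratio N :: 'a poly fract fps"
  let ?f = "truncated_bernoulli_carlitz_num N :: 'a poly fract fps"
  define q :: "'a poly fract fps"
    where "q = Abs_fps (\<lambda>n. truncated_bernoulli_carlitz N n / carlitz_factorial n)"
  \<comment> \<open>The numerator is not a unit in general, but it is nonzero and can be cancelled
    in the integral domain of power series over a field.\<close>
  have "?f * (q * (1 - ?h)) = ?f * 1"
    using truncated_bernoulli_carlitz_gf[where 'a = 'a and N = N]
    unfolding q_def truncated_bernoulli_carlitz_den_eq by (simp add: mult_ac)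
  moreover have "?f \<noteq> 0"
    by (simp add: truncated_bernoulli_carlitz_num_def carlitz_D_nonzero)
  ultimately have "q * (1 - ?h) = 1"
    by (metis mult_left_cancel)
  hence "fps_nth q n = (\<Sum>k\<le>n. fps_nth (?h ^ k) n)"
    by (rule fps_nth_geometric[OF _ truncated_bernoulli_carlitz_ratio_nth_0])
  \<comment> \<open>The term \<open>k = 0\<close> is the \<open>n\<close>-th coefficient of 1, which
    vanishes for \<open>n >= 1\<close>.\<close>
  also have "\<dots> = (\<Sum>k = 1..n. fps_nth (?h ^ k) n)"
    using \<open>n \<ge> 1\<close> by (intro sum.mono_neutral_right) (auto simp: Suc_le_eq)
  finally have "truncated_bernoulli_carlitz N n = carlitz_factorial n * (\<Sum>k = 1..n. fps_nth (?h ^ k) n)"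
    by (simp add: q_def carlitz_factorial_nonzero field_simps)
  thus ?thesis by (simp only: truncated_bernoulli_carlitz_ratio_power_nth)
qed

end
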